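(* Let $X$ be a complete uniform space whose uniformity is generated by a saturated family of pseudometrics $\{d_\lambda\}_{\lambda\in\Lambda}$. Let $\mathcal{B}$ be a filter base on $X$ such that $\mathcal{B}\subseteq\mathcal{CB}(X)$, let $E=\bigcap_{B\in\mathcal{B}}B$, and suppose $\inf\{\alpha(B):B\in\mathcal{B}\}=0$. Then $E$ is compact and nonempty, and $\mathcal{B}$ converges to $E$ in the $\mathcal{H}$-topology, i.e. for each $\lambda\in\Lambda$ and $\epsilon>0$ there exists $B\in\mathcal{B}$ such that $H^\lambda(B,E)<\epsilon$.
   Context: The family $\{d_\lambda\}$ is saturated if for all $\lambda,\mu\in\Lambda$ there is $\nu\in\Lambda$ with $\max\{d_\lambda,d_\mu\}\le d_\nu$. $X$ is complete if every Cauchy filter converges. A set $B\subseteq X$ is bounded if $B\subseteq U[x]=\{y:(x,y)\in U\}$ for some $x\in X$ and some entourage $U$; $\mathcal{B}(X)$ is the family of bounded subsets and $\mathcal{CB}(X)$ the family of closed, bounded, nonempty subsets of $X$. Put $\mathrm{B}_\lambda(a,\epsilon)=\{x\in X:d_\lambda(a,x)<\epsilon\}$ and $d_\lambda(a,A)=\inf_{x\in A}d_\lambda(a,x)$. The Hausdorff pseudometrics are $H^\lambda(A,B)=\max\{\sup_{x\in A}d_\lambda(x,B),\sup_{y\in B}d_\lambda(y,A)\}$; they generate the $\mathcal{H}$-topology on $\mathcal{CB}(X)$. Non-compactness measure: for $A\in\mathcal{B}(X)$, $\alpha(A)$ is the infimum of all $\epsilon>0$ such that for each $\lambda\in\Lambda$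 there exist finitely many $x_1,\dots,x_r\in X$ with $A\subseteq\mathrm{B}_\lambda(x_1,\epsilon/2)\cup\dots\cup\mathrm{B}_\lambda(x_r,\epsilon/2)$ (with $\inf\emptyset=+\infty$). *)

theory Defs
  imports "HOL-Library.Extended_Real"
begin

definition pseudometric :: "('a \<Rightarrow> 'a \<Rightarrow> real) \<Rightarrow> bool"
  where "pseudometric d \<longleftrightarrow>
    (\<forall>x y. 0 \<le> d x y) \<and> (\<forall>x. d x x = 0) \<and> (\<forall>x y. d x y = d y x) \<and>
    (\<forall>x y z. d x z \<le> d x y + d y z)"

definition saturated :: "'i set \<Rightarrow> ('i \<Rightarrow> 'a \<Rightarrow> 'a \<Rightarrow> real) \<Rightarrow> bool"
  where "saturated \<Lambda> d \<longleftrightarrow>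
    (\<forall>l\<in>\<Lambda>. \<forall>m\<in>\<Lambda>. \<exists>n\<in>\<Lambda>. \<forall>x y. max (d l x y) (d m x y) \<le> d n x y)"

text \<open>The infimum of filters is the filter generated by their union, so this says that the sets
  \<open>{(x, y). d l x y < e}\<close> form a subbase of the given uniformity.\<close>

definition generates_uniformity ::
    "'i set \<Rightarrow> ('i \<Rightarrow> 'a::uniform_space \<Rightarrow> 'a \<Rightarrow> real) \<Rightarrow> bool"
  where "generates_uniformity \<Lambda> d \<longleftrightarrow>
    (uniformity :: ('a \<times> 'a) filter) =
      (INF l\<in>\<Lambda>. INF e\<in>{0<..}. principal {(x, y). d l x y < e})"

text \<open>The whole product is an entourage and is not excluded here, so every subset is bounded
  in this sense.\<close>

definition uniform_bounded :: "'a::uniform_space set \<Rightarrow> bool"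
  where "uniform_bounded B \<longleftrightarrow>
    (\<exists>x U. eventually (\<lambda>p. p \<in> U) uniformity \<and> B \<subseteq> {y. (x, y) \<in> U})"

definition CB :: "'a::uniform_space set set"
  where "CB = {B. closed B \<and> uniform_bounded B \<and> B \<noteq> {}}"

definition filter_base :: "'a set set \<Rightarrow> bool"
  where "filter_base \<B> \<longleftrightarrow>
    \<B> \<noteq> {} \<and> {} \<notin> \<B> \<and> (\<forall>A\<in>\<B>. \<forall>B\<in>\<B>. \<exists>C\<in>\<B>. C \<subseteq> A \<inter> B)"

definition pball :: "('a \<Rightarrow> 'a \<Rightarrow> real) \<Rightarrow> 'a \<Rightarrow> real \<Rightarrow> 'a set"
  where "pball d a e = {x. d a x < e}"

text \<open>Distances to sets, Hausdorff pseudometrics and the measure of non-compactness are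
  extended-real valued: the suprema below need not be finite, and the infimum of the empty set
  is \<open>\<infinity>\<close>.\<close>

definition point_set_dist :: "('a \<Rightarrow> 'a \<Rightarrow> real) \<Rightarrow> 'a \<Rightarrow> 'a set \<Rightarrow> ereal"
  where "point_set_dist d a A = (INF x\<in>A. ereal (d a x))"

definition hausdorff_pdist :: "('a \<Rightarrow> 'a \<Rightarrow> real) \<Rightarrow> 'a set \<Rightarrow> 'a set \<Rightarrow> ereal"
  where "hausdorff_pdist d A B =
    max (SUP x\<in>A. point_set_dist d x B) (SUP y\<in>B. point_set_dist d y A)"

definition noncompactness :: "'i set \<Rightarrow> ('i \<Rightarrow> 'a \<Rightarrow> 'a \<Rightarrow> real) \<Rightarrow> 'a set \<Rightarrow> ereal"
  where "noncompactness \<Lambda> d A =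
    Inf {ereal e | e. 0 < e \<and>
      (\<forall>l\<in>\<Lambda>. \<exists>F. finite F \<and> A \<subseteq> (\<Union>x\<in>F. pball (d l) x (e / 2)))}"

end

theory Submission
  imports Defs "HOL-Analysis.Elementary_Topology"
begin

text \<open>Every proper filter \<open>F\<close> containing the base \<open>\<B>\<close> has a cluster point in \<open>E\<close>: refine \<open>F\<close> to an
  ultrafilter; as \<open>\<B>\<close> has members covered by finitely many arbitrarily small \<open>d l\<close>-balls, the
  ultrafilter contains such a ball for every \<open>l\<close>, so it is Cauchy and converges, and its limit lies
  in every (closed) member of \<open>\<B>\<close>. Applied to filters on \<open>E\<close> this gives compactness; applied to the
  filter generated by \<open>\<B>\<close> it gives \<open>E \<noteq> {}\<close>; and if no member of \<open>\<B>\<close> were contained in the open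
  \<open>d l\<close>-neighbourhood of \<open>E\<close> of radius \<open>e\<close>, the traces of \<open>\<B>\<close> on the complement of that
  neighbourhood would generate a filter with a cluster point in \<open>E\<close>, which is absurd.\<close>

text \<open>Zorn's lemma applied to the proper filters below \<open>F\<close>; a minimal one decides
  every set, since otherwise it could be refined further.\<close>

lemma ultrafilter_below:
  fixes F :: "'a filter"
  assumes "F \<noteq> bot"
  obtains U where "U \<le> F" "U \<noteq> bot"
    "\<And>S. eventually (\<lambda>x. x \<in> S) U \<or> eventually (\<lambda>x. x \<notin> S) U"
proof -
  let ?A = "{G. G \<noteq> bot \<and> G \<le> F}"
  \<comment> \<open>The order is reversed because Zorn's lemma yields maximal elements and a minimal
    filter is wanted.\<close>
  have po: "partial_order_on ?A (relation_of (\<lambda>a b. b \<le> a) ?A)"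
    by (rule partial_order_on_relation_ofI) auto
  have "\<exists>u\<in>?A. \<forall>a\<in>C. u \<le> a" if C: "C \<in> Chains (relation_of (\<lambda>a b. b \<le> a) ?A)" for C
  proof (cases "C = {}")
    case True
    then show ?thesis using assms by auto
  next
    case False
    have CA: "C \<subseteq> ?A" and lin: "\<And>G H. G \<in> C \<Longrightarrow> H \<in> C \<Longrightarrow> G \<le> H \<or> H \<le> G"
      using C by (auto simp: Chains_def relation_of_def)
    \<comment> \<open>A chain is directed downwards, so whatever holds eventually in
      \<open>Inf C\<close> already does so in one member; hence \<open>Inf C\<close> is
      proper.\<close>
    have "eventually P (Inf C) \<longleftrightarrow> (\<exists>G\<in>C. eventually P G)" for P
    proof (rule eventually_Inf_base[OF False])
      fix G H assume "G \<in> C" "H \<in> C"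
      then show "\<exists>x\<in>C. x \<le> inf G H"
        using lin[of G H] by auto
    qed
    then have "Inf C \<noteq> bot"
      using CA unfolding trivial_limit_def by auto
    moreover obtain G where "G \<in> C" "G \<le> F"
      using False CA by auto
    then have "Inf C \<le> F"
      by (rule Inf_lower2)
    ultimately show ?thesis
      by (auto intro: Inf_lower)
  qed
  from predicate_Zorn[OF po this]
  obtain U where U: "U \<noteq> bot" "U \<le> F" and min: "\<And>G. G \<noteq> bot \<Longrightarrow> G \<le> F \<Longrightarrow> G \<le> U \<Longrightarrow> G = U"
    by blast
  have "eventually (\<lambda>x. x \<in> S) U \<or> eventually (\<lambda>x. x \<notin> S) U" for S
  \<comment> \<open>The trace of \<open>U\<close> on \<open>S\<close> is either improper, so that
    \<open>U\<close> contains the complement of \<open>S\<close>, or equal to \<open>U\<close> by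
    minimality.\<close>
  proof (cases "inf U (principal S) = bot")
    case True
    then show ?thesis
      unfolding trivial_limit_def eventually_inf_principal by simp
  next
    case False
    then have "inf U (principal S) = U"
      using U by (intro min) (auto intro: le_infI1)
    then show ?thesis
      by (metis inf.absorb_iff1 le_principal)
  qed
  with U that show ?thesis by blast
qed

lemma generates_uniformity_eventually:
  assumes "generates_uniformity \<Lambda> d" "l \<in> \<Lambda>" "0 < e"
  shows "eventually (\<lambda>(x, y). d l x y < e) uniformity"
  unfolding assms(1)[unfolded generates_uniformity_def]
  by (rule eventually_INF1[OF assms(2)], rule eventually_INF1[of e])
    (use assms(3) in \<open>auto simp: eventually_principal\<close>)

lemma generates_uniformity_eventually_nhds:
  assumes "generates_uniformity \<Lambda> d" "l \<in> \<Lambda>" "0 < e"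
  shows "eventually (\<lambda>y. d l x y < e) (nhds x)"
  unfolding eventually_nhds_uniformity
  using generates_uniformity_eventually[OF assms] by eventually_elim auto

text \<open>Two points of one ball of radius \<open>e / 2\<close> are less than \<open>e\<close>
  apart, and being Cauchy need only be checked on the sets that generate the uniformity.\<close>

lemma cauchy_filterI_small_balls:
  fixes d :: "'i \<Rightarrow> 'a::uniform_space \<Rightarrow> 'a \<Rightarrow> real"
  assumes pm: "\<And>l. l \<in> \<Lambda> \<Longrightarrow> pseudometric (d l)"
    and gen: "generates_uniformity \<Lambda> d"
    and ball: "\<And>l e. l \<in> \<Lambda> \<Longrightarrow> 0 < e \<Longrightarrow> \<exists>x. eventually (\<lambda>y. y \<in> pball (d l) x (e / 2)) F"
  shows "cauchy_filter F"
proof -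
  have "eventually (\<lambda>p. p \<in> {(x, y). d l x y < e}) (F \<times>\<^sub>F F)" if le: "l \<in> \<Lambda>" "0 < e" for l e
  proof -
    obtain x where x: "eventually (\<lambda>y. y \<in> pball (d l) x (e / 2)) F"
      using ball[OF le] by blast
    have "d l y z < e" if "d l x y < e / 2" "d l x z < e / 2" for y z
    proof -
      have "d l y z \<le> d l y x + d l x z" "d l y x = d l x y"
        using pm[OF le(1)] unfolding pseudometric_def by blast+
      with that show ?thesis by simp
    qed
    with x show ?thesis
      unfolding eventually_prod_same pball_def by auto
  qed
  then show ?thesis
    unfolding cauchy_filter_def gen[unfolded generates_uniformity_def]
    by (auto intro!: INF_greatest simp: le_principal)
qed

lemma noncompactness_less_cover:
  assumes "noncompactness \<Lambda> d B < ereal e" "l \<in> \<Lambda>"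
  obtains F where "finite F" "B \<subseteq> (\<Union>x\<in>F. pball (d l) x (e / 2))"
proof -
  obtain r F where "r < e" "finite F" "B \<subseteq> (\<Union>x\<in>F. pball (d l) x (r / 2))"
    using assms unfolding noncompactness_def Inf_less_iff by fastforce
  moreover from \<open>r < e\<close> have "pball (d l) x (r / 2) \<subseteq> pball (d l) x (e / 2)" for x
    by (auto simp: pball_def)
  ultimately show ?thesis
    using that by (meson UN_mono order_refl subset_trans)
qed

lemma cluster_point_in_Inter:
  fixes d :: "'i \<Rightarrow> 'a::uniform_space \<Rightarrow> 'a \<Rightarrow> real"
  assumes pm: "\<And>l. l \<in> \<Lambda> \<Longrightarrow> pseudometric (d l)"
    and gen: "generates_uniformity \<Lambda> d"
    and compl: "complete (UNIV :: 'a set)"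
    and closed: "\<And>B. B \<in> \<B> \<Longrightarrow> closed B"
    and small: "(INF B\<in>\<B>. noncompactness \<Lambda> d B) = 0"
    and F: "F \<noteq> bot" "\<And>B. B \<in> \<B> \<Longrightarrow> F \<le> principal B"
  shows "\<exists>x\<in>\<Inter>\<B>. inf (nhds x) F \<noteq> bot"
proof -
  obtain U where U: "U \<le> F" "U \<noteq> bot"
    and ultra: "\<And>S. eventually (\<lambda>x. x \<in> S) U \<or> eventually (\<lambda>x. x \<notin> S) U"
    using ultrafilter_below[OF F(1)] by metis
  have UB: "eventually (\<lambda>x. x \<in> B) U" if "B \<in> \<B>" for B
    using order_trans[OF U(1) F(2)[OF that]] by (simp add: le_principal)
  have "cauchy_filter U"
  proof (rule cauchy_filterI_small_balls[OF pm gen])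
    fix l and e :: real assume l: "l \<in> \<Lambda>" and e: "0 < e"
    have "(INF B\<in>\<B>. noncompactness \<Lambda> d B) < ereal e"
      using small e by simp
    then obtain B where B: "B \<in> \<B>" "noncompactness \<Lambda> d B < ereal e"
      by (auto simp: INF_less_iff)
    obtain K where K: "finite K" "B \<subseteq> (\<Union>x\<in>K. pball (d l) x (e / 2))"
      using noncompactness_less_cover[OF B(2) l] by blast
    show "\<exists>x. eventually (\<lambda>y. y \<in> pball (d l) x (e / 2)) U"
    proof (rule ccontr)
      assume "\<not> ?thesis"
      \<comment> \<open>An ultrafilter containing none of the balls contains all their complements,
        and so, \<open>K\<close> being finite, the complement of a set that covers
        \<open>B\<close>.\<close>
      then have "eventually (\<lambda>y. \<forall>x\<in>K. y \<notin> pball (d l) x (e / 2)) U"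
        using ultra K(1) by (intro eventually_ball_finite) blast+
      with UB[OF B(1)] have "eventually (\<lambda>_. False) U"
        by eventually_elim (use K(2) in blast)
      with U(2) show False by simp
    qed
  qed auto
  then obtain x where x: "U \<le> nhds x"
    using cauchy_filter_complete_converges[OF _ compl] U(2) by auto
  have "x \<in> B" if "B \<in> \<B>" for B
  proof (rule ccontr)
    assume "x \<notin> B"
    then have "eventually (\<lambda>y. y \<in> - B) (nhds x)"
      using closed[OF that] by (intro eventually_nhds_in_open) auto
    then have "eventually (\<lambda>y. y \<in> - B) U"
      using x by (rule filter_leD[rotated])
    with UB[OF that] have "eventually (\<lambda>_. False) U"
      by eventually_elim simp
    with U(2) show False by simp
  qed
  \<comment> \<open>The proper filter \<open>U\<close> lies below both \<open>nhds x\<close> and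
    \<open>F\<close>.\<close>
  moreover have "inf (nhds x) F \<noteq> bot"
    using U x by (metis bot.extremum_uniqueI le_inf_iff)
  ultimately show ?thesis by blast
qed

text \<open>As \<open>E\<close> lies in \<open>B\<close>, only the distances from points of
  \<open>B\<close> to \<open>E\<close> matter. The bound \<open>e / 2\<close> keeps the inequality
  strict after passing to suprema.\<close>

lemma hausdorff_pdist_superset_less:
  assumes d: "pseudometric d" and e: "0 < e" and "E \<noteq> {}" "E \<subseteq> B"
    and near: "\<And>y. y \<in> B \<Longrightarrow> \<exists>x\<in>E. d x y < e / 2"
  shows "hausdorff_pdist d B E < ereal e"
proof -
  have "point_set_dist d y E \<le> ereal (e / 2)" if y: "y \<in> B" for y
  proof -
    obtain x where "x \<in> E" "d x y < e / 2" using near[OF y] by blast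
    moreover have "d y x = d x y" using d by (auto simp: pseudometric_def)
    ultimately show ?thesis
      unfolding point_set_dist_def by (intro INF_lower2[of x]) auto
  qed
  moreover have "point_set_dist d y B \<le> ereal (e / 2)" if "y \<in> E" for y
    unfolding point_set_dist_def
    using that d e \<open>E \<subseteq> B\<close> by (intro INF_lower2[of y]) (auto simp: pseudometric_def)
  ultimately have "hausdorff_pdist d B E \<le> ereal (e / 2)"
    unfolding hausdorff_pdist_def by (auto intro!: SUP_least)
  also have "\<dots> < ereal e" using e by simp
  finally show ?thesis .
qed

theorem theorem5:
  fixes \<Lambda> :: "'i set"
    and d :: "'i \<Rightarrow> 'a::uniform_space \<Rightarrow> 'a \<Rightarrow> real"
    and \<B> :: "'a set set"
    and E :: "'a set"
  assumes "\<And>l. l \<in> \<Lambda> \<Longrightarrow> pseudometric (d l)"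
    and "saturated \<Lambda> d"
    and "generates_uniformity \<Lambda> d"
    and "complete (UNIV :: 'a set)"
    and "filter_base \<B>"
    and "\<B> \<subseteq> CB"
    and "E = \<Inter>\<B>"
    and "(INF B\<in>\<B>. noncompactness \<Lambda> d B) = 0"
  shows "compact E \<and> E \<noteq> {} \<and>
    (\<forall>l\<in>\<Lambda>. \<forall>e::real. 0 < e \<longrightarrow> (\<exists>B\<in>\<B>. hausdorff_pdist (d l) B E < ereal e))"
proof -
  note pm = assms(1) and gen = assms(3) and fb = assms(5) and E = assms(7)
  note cluster = cluster_point_in_Inter[OF pm gen assms(4) _ assms(8), folded E]
  have closed: "\<And>B. B \<in> \<B> \<Longrightarrow> closed B"
    using assms(6) by (auto simp: CB_def)
  \<comment> \<open>The traces on \<open>S\<close> again form a filter base. Taking \<open>S\<close>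
    to be \<open>UNIV\<close> will give \<open>E \<noteq> {}\<close>; the complement of a
    neighbourhood of \<open>E\<close> will give convergence.\<close>
  have base: "(INF B\<in>\<B>. principal (B \<inter> S)) \<noteq> bot" if S: "\<And>B. B \<in> \<B> \<Longrightarrow> B \<inter> S \<noteq> {}" for S
  proof -
    have "eventually P (INF B\<in>\<B>. principal (B \<inter> S)) \<longleftrightarrow>
        (\<exists>B\<in>\<B>. eventually P (principal (B \<inter> S)))" for P
    proof (rule eventually_INF_base)
      fix A B assume "A \<in> \<B>" "B \<in> \<B>"
      then obtain C where "C \<in> \<B>" "C \<subseteq> A \<inter> B"
        using fb unfolding filter_base_def by meson
      then show "\<exists>C\<in>\<B>. principal (C \<inter> S) \<le> inf (principal (A \<inter> S)) (principal (B \<inter> S))"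
        by (intro bexI[of _ C]) auto
    qed (use fb in \<open>auto simp: filter_base_def\<close>)
    then show ?thesis
      using S unfolding trivial_limit_def by (auto simp: eventually_principal Int_def)
  qed
  have below: "(INF B\<in>\<B>. principal (B \<inter> S)) \<le> principal B" if "B \<in> \<B>" for S B
    using that by (intro INF_lower2[of B]) auto
  have "compact E"
    unfolding compact_filter
  proof (intro allI impI)
    fix F assume "F \<noteq> bot" "eventually (\<lambda>x. x \<in> E) F"
    \<comment> \<open>A filter containing \<open>E\<close> contains every larger set, in particular
      each member of \<open>\<B>\<close>.\<close>
    then show "\<exists>x\<in>E. inf (nhds x) F \<noteq> bot"
      by (intro cluster closed) (auto simp: E le_principal elim: eventually_mono)
  qed
  moreover have "E \<noteq> {}"
    using cluster[OF _ closed base below, of UNIV] fb by (auto simp: filter_base_def)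
  moreover have "\<exists>B\<in>\<B>. hausdorff_pdist (d l) B E < ereal e" if l: "l \<in> \<Lambda>" and e: "0 < e" for l e
  proof -
    \<comment> \<open>\<open>S\<close> consists of the points outside the open
      \<open>e / 2\<close>-neighbourhood of \<open>E\<close>, so any \<open>B\<close> that misses
      \<open>S\<close> satisfies the hypothesis of
      \<open>hausdorff_pdist_superset_less\<close>.\<close>
    define S where "S = {y. \<forall>x\<in>E. \<not> d l x y < e / 2}"
    have "\<exists>B\<in>\<B>. B \<inter> S = {}"
    proof (rule ccontr)
      assume "\<not> ?thesis"
      then obtain x where x: "x \<in> E" "inf (nhds x) (INF B\<in>\<B>. principal (B \<inter> S)) \<noteq> bot"
        using cluster[OF _ closed base below, of S] by blast
      obtain B where "B \<in> \<B>" using fb by (auto simp: filter_base_def)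
      then have "(INF B\<in>\<B>. principal (B \<inter> S)) \<le> principal S"
        by (intro INF_lower2[of B]) auto
      \<comment> \<open>Since \<open>x\<close> is in \<open>E\<close>, the \<open>d l\<close>-ball
        of radius \<open>e / 2\<close> around it is a neighbourhood that misses
        \<open>S\<close>.\<close>
      moreover have "inf (nhds x) (principal S) = bot"
        using generates_uniformity_eventually_nhds[OF gen l, of "e / 2" x] e x(1)
        by (auto simp: trivial_limit_def eventually_inf_principal S_def elim!: eventually_mono)
      ultimately show False
        using x(2) by (metis bot.extremum_uniqueI inf_mono order_refl)
    qed
    then obtain B where "B \<in> \<B>" "B \<inter> S = {}" by blast
    then show ?thesis
      using \<open>E \<noteq> {}\<close>
      by (intro bexI[of _ B] hausdorff_pdist_superset_less pm l e) (auto simp: S_def E)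
  qed
  ultimately show ?thesis by blast
qed

end
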